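(* Suppose that $h$ is a Bregman function with zone $C$, that $f$ is linear, and that $S(P)\neq\emptyset$. Then the solution $x(t)$ of $(H\text{-}SD)$, $$\dot x(t)+\nabla_Hf_{|\mathcal{F}}(x(t))=0,\quad x(0)=x^0\in\mathcal{F},$$ converges as $t\to+\infty$ to the unique optimal solution $x^*$ of $$\min_{x\in S(P)}D_h(x,x^0).$$
   Context: Let $m<n$ be positive integers, $A\in\mathbb{R}^{m\times n}$ of full rank, $b\in\operatorname{Im}A$, $\mathcal{A}=\{x\in\mathbb{R}^n: Ax=b\}$, $\mathcal{A}_0=\ker A$. Let $C\subset\mathbb{R}^n$ be nonempty, open and convex, with $\mathcal{F}=C\cap\mathcal{A}\neq\emptyset$. $f:\mathbb{R}^n\to\mathbb{R}$ is the objective function and $S(P)$ is the set of optimal solutions of $(P)$: $\inf\{f(x)\mid x\in\overline{C},\ Ax=b\}$. $\Gamma_0(\mathbb{R}^n)$ is the set of lower semicontinuous proper convex functions $\mathbb{R}^n\to\mathbb{R}\cup\{+\infty\}$. A function $h\in\Gamma_0(\mathbb{R}^n)$ is of Legendre type if it is differentiable on $\operatorname{int}\operatorname{dom}h$, $|\nabla h(x^j)|\to+\infty$ for every sequence $(x^j)\subset\operatorname{int}\operatorname{dom}h$ converging to a boundary point of $\operatorname{dom}h$, and $h$ is strictly convex on $\operatorname{int}\operatorname{dom}h$. The function $h\in\Gamma_0(\mathbb{R}^n)$ is assumed to satisfy: (i) $h$ is of Legendre type with $\operatorname{int}\operatorname{dom}h=C$; (ii) $h_{|C}\in\mathcal{C}^2(C;\mathbb{R})$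 and $\nabla^2h(x)$ is symmetric positive definite for all $x\in C$; (iii) $x\mapsto\nabla^2h(x)$ is locally Lipschitz continuous on $C$. Set $H=\nabla^2h$ on $C$, and $D_h(x,y)=h(x)-h(y)-\langle\nabla h(y),x-y\rangle$ for $x\in\operatorname{dom}h$, $y\in C$. A function $h\in\Gamma_0(\mathbb{R}^n)$ is a Bregman function with zone $C$ if: (i) $\operatorname{dom}h=\overline{C}$, $h$ is continuous and strictly convex on $\overline{C}$ and $h_{|C}\in\mathcal{C}^1(C;\mathbb{R})$; (ii) for all $a\in\overline{C}$ and $\gamma\in\mathbb{R}$, $\{y\in C\mid D_h(a,y)\le\gamma\}$ is bounded; (iii) for all $y\in\overline{C}$ and all sequences $y^j\to y$ with $y^j\in C$, $D_h(y,y^j)\to0$. On the submanifold $\mathcal{F}$, with tangent space $\mathcal{A}_0$, consider the Riemannian metric $(u,v)^H_x=\langle H(x)u,v\rangle$; the gradient of $f_{|\mathcal{F}}$ is $\nabla_Hf_{|\mathcal{F}}(x)=H(x)^{-1}[I-A^T(AH(x)^{-1}A^T)^{-1}AH(x)^{-1}]\nabla f(x)$. Under the stated assumptions the solution exists for all $t\ge0$. *)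

theory Defs
  imports "HOL-Analysis.Analysis"
begin

section \<open>Extended-real-valued convex functions\<close>

text \<open>Functions with values in the reals extended by plus infinity have type
  \<^typ>\<open>real ^ 'n \<Rightarrow> ereal\<close>; the value minus infinity is excluded by \<open>proper_fun\<close>.\<close>

definition edom :: "('a \<Rightarrow> ereal) \<Rightarrow> 'a set" where
  "edom h = {x. h x < \<infinity>}"

text \<open>Only meaningful on \<open>edom h\<close>: \<^const>\<open>real_of_ereal\<close> maps infinity to 0.\<close>
abbreviation real_part :: "('a \<Rightarrow> ereal) \<Rightarrow> 'a \<Rightarrow> real" where
  "real_part h \<equiv> (\<lambda>x. real_of_ereal (h x))"

definition proper_fun :: "('a \<Rightarrow> ereal) \<Rightarrow> bool" where
  "proper_fun h \<longleftrightarrow> (\<forall>x. h x \<noteq> -\<infinity>) \<and> edom h \<noteq> {}"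

definition lower_semicont :: "('a::topological_space \<Rightarrow> ereal) \<Rightarrow> bool" where
  "lower_semicont h \<longleftrightarrow> (\<forall>x. h x \<le> Liminf (at x) h)"

definition convex_fun :: "('a::real_vector \<Rightarrow> ereal) \<Rightarrow> bool" where
  "convex_fun h \<longleftrightarrow> (\<forall>x y u. 0 < u \<and> u < 1 \<longrightarrow>
     h ((1 - u) *\<^sub>R x + u *\<^sub>R y) \<le> ereal (1 - u) * h x + ereal u * h y)"

definition Gamma0 :: "(real ^ 'n \<Rightarrow> ereal) set" where
  "Gamma0 = {h. proper_fun h \<and> lower_semicont h \<and> convex_fun h}"

definition strictly_convex_on :: "'a::real_vector set \<Rightarrow> ('a \<Rightarrow> real) \<Rightarrow> bool" where
  "strictly_convex_on S g \<longleftrightarrow> convex S \<and>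
     (\<forall>x\<in>S. \<forall>y\<in>S. \<forall>u. x \<noteq> y \<and> 0 < u \<and> u < 1 \<longrightarrow>
        g ((1 - u) *\<^sub>R x + u *\<^sub>R y) < (1 - u) * g x + u * g y)"


section \<open>Gradient and Hessian\<close>

definition gradient :: "('a::real_inner \<Rightarrow> real) \<Rightarrow> 'a \<Rightarrow> 'a" where
  "gradient g x = (THE D. GDERIV g x :> D)"

definition hessian :: "(real ^ 'n \<Rightarrow> real) \<Rightarrow> real ^ 'n \<Rightarrow> real ^ 'n ^ 'n" where
  "hessian g x = jacobian (gradient g) (at x)"

text \<open>The two notions below are used for open \<open>C\<close> only.\<close>

definition C1_on :: "(real ^ 'n) set \<Rightarrow> (real ^ 'n \<Rightarrow> real) \<Rightarrow> bool" where
  "C1_on C g \<longleftrightarrow> (\<forall>x\<in>C. g differentiable (at x)) \<and> continuous_on C (gradient g)"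

definition C2_on :: "(real ^ 'n) set \<Rightarrow> (real ^ 'n \<Rightarrow> real) \<Rightarrow> bool" where
  "C2_on C g \<longleftrightarrow> C1_on C g \<and> (\<forall>x\<in>C. gradient g differentiable (at x)) \<and>
     continuous_on C (hessian g)"

definition sym_pos_def :: "real ^ 'n ^ 'n \<Rightarrow> bool" where
  "sym_pos_def M \<longleftrightarrow> transpose M = M \<and> (\<forall>v. v \<noteq> 0 \<longrightarrow> 0 < (M *v v) \<bullet> v)"

definition locally_lipschitz_on :: "'a::metric_space set \<Rightarrow> ('a \<Rightarrow> 'b::metric_space) \<Rightarrow> bool" where
  "locally_lipschitz_on C g \<longleftrightarrow> (\<forall>x\<in>C. \<exists>e>0. \<exists>L. L-lipschitz_on (C \<inter> ball x e) g)"


section \<open>Legendre and Bregman functions\<close>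

definition legendre_type :: "(real ^ 'n \<Rightarrow> ereal) \<Rightarrow> bool" where
  "legendre_type h \<longleftrightarrow> h \<in> Gamma0 \<and>
     (\<forall>x\<in>interior (edom h). real_part h differentiable (at x)) \<and>
     (\<forall>X z. (\<forall>j::nat. X j \<in> interior (edom h)) \<and> z \<in> frontier (edom h) \<and> X \<longlonglongrightarrow> z \<longrightarrow>
        filterlim (\<lambda>j. norm (gradient (real_part h) (X j))) at_top sequentially) \<and>
     strictly_convex_on (interior (edom h)) (real_part h)"

text \<open>To be used for \<open>x \<in> edom h\<close> and \<open>y \<in> interior (edom h)\<close>.\<close>
definition bregman_dist :: "(real ^ 'n \<Rightarrow> ereal) \<Rightarrow> real ^ 'n \<Rightarrow> real ^ 'n \<Rightarrow> real" where
  "bregman_dist h x y =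
     real_part h x - real_part h y - gradient (real_part h) y \<bullet> (x - y)"

definition bregman_function :: "(real ^ 'n) set \<Rightarrow> (real ^ 'n \<Rightarrow> ereal) \<Rightarrow> bool" where
  "bregman_function C h \<longleftrightarrow> h \<in> Gamma0 \<and>
     (edom h = closure C \<and> continuous_on (closure C) h \<and>
        strictly_convex_on (closure C) (real_part h) \<and> C1_on C (real_part h)) \<and>
     (\<forall>a\<in>closure C. \<forall>\<gamma>. bounded {y \<in> C. bregman_dist h a y \<le> \<gamma>}) \<and>
     (\<forall>y\<in>closure C. \<forall>Y. (\<forall>j::nat. Y j \<in> C) \<and> Y \<longlonglongrightarrow> y \<longrightarrow>
        (\<lambda>j. bregman_dist h y (Y j)) \<longlonglongrightarrow> 0)"


section \<open>The optimization problem and its Riemannian gradient flow\<close>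

definition affine_constraint :: "real ^ 'n ^ 'm \<Rightarrow> real ^ 'm \<Rightarrow> (real ^ 'n) set" where
  "affine_constraint A b = {x. A *v x = b}"

definition optimal_set ::
    "(real ^ 'n) set \<Rightarrow> real ^ 'n ^ 'm \<Rightarrow> real ^ 'm \<Rightarrow> (real ^ 'n \<Rightarrow> real) \<Rightarrow> (real ^ 'n) set" where
  "optimal_set C A b f = {x. is_arg_min f (\<lambda>y. y \<in> closure C \<and> A *v y = b) x}"

definition riem_inner :: "real ^ 'n ^ 'n \<Rightarrow> real ^ 'n \<Rightarrow> real ^ 'n \<Rightarrow> real" where
  "riem_inner M u v = (M *v u) \<bullet> v"

text \<open>The gradient at \<open>x\<close> of the restriction of \<open>f\<close> to the submanifold with tangent space
  \<open>ker A\<close>: the tangent vector representing the differential of \<open>f\<close> on \<open>ker A\<close> with respect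
  to the metric \<open>H x\<close>. The explicit formula is lemma \<open>riemannian_gradient_eq\<close> below.\<close>
definition riemannian_gradient ::
    "(real ^ 'n \<Rightarrow> real ^ 'n ^ 'n) \<Rightarrow> real ^ 'n ^ 'm \<Rightarrow> (real ^ 'n \<Rightarrow> real) \<Rightarrow> real ^ 'n \<Rightarrow> real ^ 'n" where
  "riemannian_gradient H A f x = (THE g. A *v g = 0 \<and>
     (\<forall>v. A *v v = 0 \<longrightarrow> riem_inner (H x) g v = frechet_derivative f (at x) v))"

definition HSD_solution ::
    "(real ^ 'n) set \<Rightarrow> (real ^ 'n \<Rightarrow> real ^ 'n ^ 'n) \<Rightarrow> real ^ 'n ^ 'm \<Rightarrow> (real ^ 'n \<Rightarrow> real) \<Rightarrow>
     real ^ 'n \<Rightarrow> (real \<Rightarrow> real ^ 'n) \<Rightarrow> bool" where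
  "HSD_solution F H A f x0 x \<longleftrightarrow> x 0 = x0 \<and>
     (\<forall>t\<ge>0. x t \<in> F \<and>
        (x has_vector_derivative - riemannian_gradient H A f (x t)) (at t within {0..}))"


section \<open>Explicit formula for the Riemannian gradient\<close>

lemma GDERIV_gradient:
  fixes f :: "real ^ 'n \<Rightarrow> real"
  assumes "f differentiable (at x)"
  shows "GDERIV f x :> gradient f x"
proof -
  obtain f' where f': "(f has_derivative f') (at x)"
    using assms by (auto simp: differentiable_def)
  have lin: "linear f'" using f' by (rule has_derivative_linear)
  have f'_eq: "f' v = v \<bullet> adjoint f' 1" for v
    using adjoint_works[OF lin, of v 1] by (simp add: inner_commute)
  have ex: "GDERIV f x :> adjoint f' 1"
    unfolding gderiv_def by (rule has_derivative_eq_rhs[OF f'], rule ext, rule f'_eq)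
  have unique: "D = D'" if "GDERIV f x :> D" "GDERIV f x :> D'" for D D'
  proof -
    have "(\<lambda>v. v \<bullet> D) = (\<lambda>v. v \<bullet> D')"
      using that has_derivative_unique unfolding gderiv_def by blast
    then have "\<forall>v. v \<bullet> D = v \<bullet> D'" by (intro allI) (rule fun_cong)
    then show ?thesis by (rule iffD1[OF vector_eq_ldot])
  qed
  show ?thesis
    unfolding gradient_def by (rule theI[of "\<lambda>D. GDERIV f x :> D", OF ex]) (rule unique[OF _ ex])
qed

lemma matrix_inv_works:
  assumes "invertible M"
  shows "M ** matrix_inv M = mat 1" "matrix_inv M ** M = mat 1"
proof -
  have "M ** matrix_inv M = mat 1 \<and> matrix_inv M ** M = mat 1"
    using assms unfolding invertible_def matrix_inv_def by (rule someI_ex)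
  then show "M ** matrix_inv M = mat 1" "matrix_inv M ** M = mat 1" by auto
qed

lemma invertible_of_inj:
  fixes M :: "real ^ 'n ^ 'n"
  assumes "\<And>v. M *v v = 0 \<Longrightarrow> v = 0"
  shows "invertible M"
  unfolding invertible_left_inverse matrix_left_invertible_ker using assms by blast

lemma riemannian_gradient_eq:
  fixes A :: "real ^ 'n ^ 'm"
  assumes spd: "sym_pos_def (H x)"
    and full_rank: "rank A = CARD('m)"
    and diff: "f differentiable (at x)"
  shows "riemannian_gradient H A f x =
    (matrix_inv (H x) **
      (mat 1 - transpose A ** matrix_inv (A ** matrix_inv (H x) ** transpose A) ** A
                 ** matrix_inv (H x))) *v gradient f x"
    (is "_ = ?g")
    and "A *v riemannian_gradient H A f x = 0"
    and "A *v v = 0 \<Longrightarrow> riem_inner (H x) (riemannian_gradient H A f x) v = gradient f x \<bullet> v"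
proof -
  let ?M = "H x" and ?c = "gradient f x"
  define I where "I = matrix_inv ?M"
  define G where "G = A ** I ** transpose A"
  have pos: "0 < (?M *v v) \<bullet> v" if "v \<noteq> 0" for v
    using spd that by (auto simp: sym_pos_def_def)
  have "invertible ?M"
    by (rule invertible_of_inj) (use pos in fastforce)
  note I = matrix_inv_works[OF this, folded I_def]
  have MI: "?M *v (I *v v) = v" for v
    using I by (simp add: matrix_vector_mul_assoc)
  have injT: "w = 0" if "transpose A *v w = 0" for w
  proof -
    have "inj ((*v) (transpose A))"
      using full_rank full_rank_injective[of "transpose A"] by (simp add: rank_transpose)
    then show ?thesis by (rule injD) (simp only: that matrix_vector_mult_0_right)
  qed
  have "invertible G"
  proof (rule invertible_of_inj)
    fix w assume w: "G *v w = 0"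
    define u where "u = I *v (transpose A *v w)"
    have "A *v u = 0"
      using w by (simp only: G_def u_def matrix_vector_mul_assoc matrix_mul_assoc)
    moreover have "(?M *v u) \<bullet> u = w \<bullet> (A *v u)"
      unfolding u_def MI by (simp add: dot_lmul_matrix[symmetric])
    ultimately have "u = 0" using pos by fastforce
    then have "transpose A *v w = 0"
      using MI[of "transpose A *v w"] unfolding u_def by simp
    then show "w = 0" by (rule injT)
  qed
  note G = matrix_inv_works[OF this]
  define w where "w = matrix_inv G *v (A *v (I *v ?c))"
  have g: "?g = I *v (?c - transpose A *v w)"
    unfolding w_def G_def[symmetric] I_def[symmetric]
    by (simp add: matrix_vector_mul_assoc[symmetric] matrix_vector_mult_diff_rdistrib)
  have Gw: "G *v w = A *v (I *v ?c)"
    unfolding w_def using G by (simp add: matrix_vector_mul_assoc matrix_mul_assoc)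
  have tangent: "A *v ?g = 0"
    unfolding g using Gw
    by (simp only: matrix_vector_mult_diff_distrib matrix_vector_mul_assoc matrix_mul_assoc G_def
        diff_self)
  have df: "frechet_derivative f (at x) = (\<lambda>v. v \<bullet> ?c)"
    using GDERIV_gradient[OF diff] unfolding gderiv_def
    by (rule frechet_derivative_at[symmetric])
  define q where "q = ?g"
  have dual: "riem_inner ?M q v = ?c \<bullet> v" if "A *v v = 0" for v
    using that unfolding riem_inner_def q_def g MI
    by (simp add: inner_diff_left dot_lmul_matrix)
  have tangent_q: "A *v q = 0" using tangent by (simp only: q_def)
  have eq: "riemannian_gradient H A f x = q"
    unfolding riemannian_gradient_def
  proof (rule the_equality)
    show "A *v q = 0 \<and> (\<forall>v. A *v v = 0 \<longrightarrow> riem_inner ?M q v = frechet_derivative f (at x) v)"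
      using tangent_q dual df by (simp add: inner_commute)
  next
    fix k assume k: "A *v k = 0 \<and>
      (\<forall>v. A *v v = 0 \<longrightarrow> riem_inner ?M k v = frechet_derivative f (at x) v)"
    let ?d = "k - q"
    have d0: "A *v ?d = 0" using k tangent_q by (simp add: matrix_vector_mult_diff_distrib)
    then have "riem_inner ?M k ?d = ?c \<bullet> ?d"
      using k by (simp add: df inner_commute)
    then have "(?M *v ?d) \<bullet> ?d = 0"
      using dual[OF d0]
      by (simp add: riem_inner_def matrix_vector_mult_diff_distrib inner_diff_left)
    then show "k = q" using pos[of ?d] by fastforce
  qed
  show "riemannian_gradient H A f x = ?g" using eq by (simp only: q_def)
  show "A *v riemannian_gradient H A f x = 0" unfolding eq by (rule tangent_q)
  show "riem_inner ?M (riemannian_gradient H A f x) v = ?c \<bullet> v" if "A *v v = 0"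
    unfolding eq using that by (rule dual)
qed

end

theory Submission
  imports Defs
begin

text \<open>
  Integrating the flow once gives \<open>\<nabla>h(x(t)) - \<nabla>h(x\<^sup>0) + t \<nabla>f \<in> (ker A)\<^sup>\<bottom>\<close>, so by the three-point
  identity, for feasible \<open>y\<close>,
  \<open>D\<^sub>h(y,x\<^sup>0) + t f(y) = D\<^sub>h(y,x(t)) + D\<^sub>h(x(t),x\<^sup>0) + t f(x(t))\<close>.
  Taking \<open>y\<close> optimal, all three of the quantities \<open>D\<^sub>h(y,x(t))\<close>, \<open>D\<^sub>h(x(t),x\<^sup>0)\<close> and
  \<open>t (f(x(t)) - f(y))\<close> are nonnegative, hence bounded by \<open>D\<^sub>h(y,x\<^sup>0)\<close>. The first bound makes the trajectory
  bounded, the third makes its cluster points optimal, and the second makes them minimizers of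
  \<open>D\<^sub>h(\<cdot>,x\<^sup>0)\<close> over the optimal set; by strict convexity there is only one such point.
\<close>

text \<open>If convergence failed, arbitrarily late times would keep \<open>x\<close> away from
  \<open>l\<close>; by boundedness a subsequence of these values converges, and its limit would have
  to be \<open>l\<close>.\<close>

lemma tendsto_of_unique_cluster_point:
  fixes x :: "real \<Rightarrow> 'a::heine_borel"
  assumes bdd: "bounded (x ` {a..})"
    and uniq: "\<And>s z. filterlim s at_top sequentially \<Longrightarrow> (\<lambda>n. x (s n)) \<longlonglongrightarrow> z \<Longrightarrow> z = l"
  shows "(x \<longlongrightarrow> l) at_top"
proof (rule ccontr)
  assume "\<not> (x \<longlongrightarrow> l) at_top"
  then obtain e where e: "e > 0" "\<And>N. \<exists>t\<ge>N. \<not> dist (x t) l < e"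
    unfolding tendsto_iff eventually_at_top_linorder by blast
  \<comment> \<open>The bound \<open>max a (real n)\<close> keeps the times where \<open>x\<close>
    is bounded and drives them to infinity.\<close>
  then have "\<exists>t. t \<ge> max a (real n) \<and> \<not> dist (x t) l < e" for n by blast
  then obtain t where t: "\<And>n. t n \<ge> max a (real n)" "\<And>n. \<not> dist (x (t n)) l < e" by metis
  have t_top: "filterlim t at_top sequentially"
    by (rule filterlim_at_top_mono[OF filterlim_real_sequentially]) (use t(1) in auto)
  have "bounded (range (x \<circ> t))"
    by (rule bounded_subset[OF bdd]) (use t(1) in auto)
  then obtain z r where r: "strict_mono (r :: nat \<Rightarrow> nat)" "((x \<circ> t) \<circ> r) \<longlonglongrightarrow> z"
    using bounded_imp_convergent_subsequence by blast
  have "filterlim (t \<circ> r) at_top sequentially"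
    unfolding comp_def by (rule filterlim_compose[OF t_top filterlim_subseq[OF r(1)]])
  then have "z = l" using r(2) by (intro uniq[of "t \<circ> r"]) (simp_all add: comp_def)
  then have "\<forall>\<^sub>F n in sequentially. dist (x (t (r n))) l < e"
    using tendstoD[OF r(2) e(1)] by simp
  then show False using t(2) by (auto dest: eventually_happens)
qed

lemma strictly_convex_on_le:
  assumes "strictly_convex_on S \<phi>" "x \<in> S" "y \<in> S" "0 \<le> u" "u \<le> 1"
  shows "\<phi> ((1 - u) *\<^sub>R x + u *\<^sub>R y) \<le> (1 - u) * \<phi> x + u * \<phi> y"
proof (cases "x = y \<or> u = 0 \<or> u = 1")
  case True
  then show ?thesis by (auto simp: scaleR_left_distrib[symmetric] algebra_simps)
next
  case False
  then show ?thesis using assms by (intro less_imp_le) (auto simp: strictly_convex_on_def)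
qed

text \<open>On the segment from \<open>x\<close> to \<open>y\<close>, subtracting the chord leaves a
  function that convexity keeps at or below its value at \<open>x\<close>, so its slope there cannot
  be positive. The gradient is taken at \<open>x\<close> alone, so \<open>y\<close> may be a
  boundary point when this yields nonnegativity of \<open>bregman_dist\<close>.\<close>

lemma strictly_convex_on_above_tangent:
  fixes \<phi> :: "real ^ 'n \<Rightarrow> real"
  assumes sc: "strictly_convex_on S \<phi>" and "x \<in> S" "y \<in> S" and diff: "\<phi> differentiable (at x)"
  shows "gradient \<phi> x \<bullet> (y - x) \<le> \<phi> y - \<phi> x"
proof (rule ccontr)
  assume neg: "\<not> ?thesis"
  define \<psi> where "\<psi> u = \<phi> (x + u *\<^sub>R (y - x)) - u * (\<phi> y - \<phi> x)" for u :: real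
  have "(\<phi> has_derivative (\<lambda>v. v \<bullet> gradient \<phi> x)) (at (x + 0 *\<^sub>R (y - x)))"
    using GDERIV_gradient[OF diff] by (simp add: gderiv_def)
  then have "((\<lambda>u. \<phi> (x + u *\<^sub>R (y - x))) has_derivative
      (\<lambda>u. (u *\<^sub>R (y - x)) \<bullet> gradient \<phi> x)) (at 0)"
    by (rule has_derivative_compose[rotated]) (auto intro!: derivative_eq_intros)
  then have "(\<psi> has_derivative (\<lambda>u. (u *\<^sub>R (y - x)) \<bullet> gradient \<phi> x - u * (\<phi> y - \<phi> x))) (at 0)"
    unfolding \<psi>_def by (auto intro!: derivative_eq_intros)
  then have "(\<psi> has_real_derivative (gradient \<phi> x \<bullet> (y - x) - (\<phi> y - \<phi> x))) (at 0)"
    unfolding has_field_derivative_def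
    by (rule has_derivative_eq_rhs) (auto simp: fun_eq_iff inner_commute algebra_simps)
  from DERIV_pos_inc_right[OF this] neg obtain d
    where d: "d > 0" "\<And>u. 0 < u \<Longrightarrow> u < d \<Longrightarrow> \<psi> 0 < \<psi> u" by auto
  \<comment> \<open>Less than \<open>d\<close> for the strict increase, at most 1 for the convexity
    inequality.\<close>
  define u where "u = min (d / 2) 1"
  have u: "0 < u" "u < d" "u \<le> 1" using d(1) by (auto simp: u_def)
  have eq: "x + u *\<^sub>R (y - x) = (1 - u) *\<^sub>R x + u *\<^sub>R y" by (simp add: algebra_simps)
  have "\<psi> u \<le> \<psi> 0"
    using strictly_convex_on_le[OF sc \<open>x \<in> S\<close> \<open>y \<in> S\<close>, of u] u
    unfolding \<psi>_def eq by (simp add: algebra_simps)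
  with d(2)[OF u(1,2)] show False by simp
qed

text \<open>The values of \<open>h\<close> at \<open>x\<close> cancel and the inner products
  regroup. The last term is the one that the flow evaluates, since \<open>y - x\<close> lies in the
  kernel of \<open>A\<close> for feasible points.\<close>

lemma bregman_three_points:
  "bregman_dist h y x0 = bregman_dist h y x + bregman_dist h x x0 +
     (gradient (real_part h) x - gradient (real_part h) x0) \<bullet> (y - x)"
  by (simp add: bregman_dist_def algebra_simps inner_diff_left inner_diff_right)

text \<open>A linear map is its own derivative, so one vector represents it at every
  \<open>x\<close>; this is what lets the flow be integrated in closed form.\<close>

lemma linear_inner_gradient:
  fixes f :: "real ^ 'n \<Rightarrow> real"
  assumes "linear f"
  shows "gradient f x \<bullet> v = f v"
proof -
  have D: "(f has_derivative f) (at x)" using assms by (rule linear_imp_has_derivative)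
  then have "GDERIV f x :> gradient f x" by (intro GDERIV_gradient) (auto simp: differentiable_def)
  then have "f = (\<lambda>v. v \<bullet> gradient f x)"
    unfolding gderiv_def using has_derivative_unique[OF D] by blast
  then show ?thesis by (metis inner_commute)
qed

lemma hessian_has_derivative:
  assumes "gradient \<phi> differentiable (at x)"
  shows "(gradient \<phi> has_derivative (*v) (hessian \<phi> x)) (at x)"
  using assms unfolding hessian_def by (simp add: jacobian_works)

text \<open>By the chain rule the velocity appears multiplied by the Hessian, which is the matrix of
  the metric. Paired with a tangent vector \<open>v\<close>, this product is minus the differential
  of \<open>f\<close>, here the constant \<open>- f v\<close>.\<close>

lemma HSD_solution_gradient:
  fixes A :: "real ^ 'n ^ 'm" and \<phi> f :: "real ^ 'n \<Rightarrow> real"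
  assumes rank: "rank A = CARD('m)" and f: "linear f"
    and C2: "C2_on C \<phi>" and "F \<subseteq> C"
    and spd: "\<And>y. y \<in> C \<Longrightarrow> sym_pos_def (hessian \<phi> y)"
    and sol: "HSD_solution F (hessian \<phi>) A f x0 x"
    and "t \<ge> 0" "A *v v = 0"
  shows "(gradient \<phi> (x t) - gradient \<phi> x0) \<bullet> v = - t * f v"
proof -
  define G where "G s = gradient \<phi> (x s) \<bullet> v + s * f v" for s
  \<comment> \<open>One-sided at time 0, since the flow equation says nothing about negative
    times.\<close>
  have "(G has_derivative (\<lambda>_. 0)) (at s within {0..})" if "s \<in> {0..}" for s
  proof -
    let ?g = "riemannian_gradient (hessian \<phi>) A f (x s)"
    have xs: "x s \<in> C" and dx: "(x has_vector_derivative - ?g) (at s within {0..})"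
      using sol that \<open>F \<subseteq> C\<close> by (auto simp: HSD_solution_def)
    have "gradient \<phi> differentiable (at (x s))" using C2 xs by (auto simp: C2_on_def)
    from has_derivative_compose[OF dx[unfolded has_vector_derivative_def]
        hessian_has_derivative[OF this]]
    have "((\<lambda>s. gradient \<phi> (x s)) has_derivative (\<lambda>r. hessian \<phi> (x s) *v (r *\<^sub>R - ?g)))
        (at s within {0..})" .
    then have "(G has_derivative (\<lambda>r. (hessian \<phi> (x s) *v (r *\<^sub>R - ?g)) \<bullet> v + r * f v))
        (at s within {0..})"
      unfolding G_def by (auto intro!: derivative_eq_intros)
    moreover have "(hessian \<phi> (x s) *v (r *\<^sub>R - ?g)) \<bullet> v = - r * f v" for r
    proof -
      have "f differentiable (at (x s))"
        using f by (intro linear_imp_differentiable)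
      from riemannian_gradient_eq(3)[where H = "hessian \<phi>", OF spd[OF xs] rank this \<open>A *v v = 0\<close>]
      have "(hessian \<phi> (x s) *v ?g) \<bullet> v = f v"
        by (simp add: riem_inner_def linear_inner_gradient[OF f])
      moreover have "hessian \<phi> (x s) *v (r *\<^sub>R - ?g) = (- r) *\<^sub>R (hessian \<phi> (x s) *v ?g)"
        by (metis matrix_vector_mult_scaleR scaleR_minus_left scaleR_minus_right)
      ultimately show ?thesis by simp
    qed
    ultimately show ?thesis by simp
  qed
  then have "G t = G 0"
    using \<open>t \<ge> 0\<close> by (intro has_derivative_zero_unique[of "{0..}" G]) auto
  moreover have "x 0 = x0" using sol by (simp add: HSD_solution_def)
  ultimately show ?thesis by (simp add: G_def inner_diff_left)
qed

text \<open>In its first argument \<open>bregman_dist\<close> is \<open>real_part h\<close> plus an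
  affine map, so it is strictly convex too, and the midpoint of two distinct minimizers would fall
  below the minimum.\<close>

lemma unique_arg_min_bregman_dist:
  assumes sc: "strictly_convex_on S (real_part h)" and "T \<subseteq> S" "convex T"
    and z: "is_arg_min (\<lambda>y. bregman_dist h y x0) (\<lambda>y. y \<in> T) z"
    and w: "is_arg_min (\<lambda>y. bregman_dist h y x0) (\<lambda>y. y \<in> T) w"
  shows "z = w"
proof (rule ccontr)
  assume "z \<noteq> w"
  let ?m = "(1 - 1 / 2) *\<^sub>R z + (1 / 2) *\<^sub>R w"
  let ?g = "gradient (real_part h) x0"
  have zw: "z \<in> T" "w \<in> T" using z w by (auto simp: is_arg_min_linorder)
  have "?m \<in> T" using \<open>convex T\<close> zw by (intro convexD) auto
  then have "bregman_dist h z x0 \<le> bregman_dist h ?m x0" "bregman_dist h w x0 \<le> bregman_dist h ?m x0"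
    using z w by (simp_all add: is_arg_min_linorder)
  moreover have "real_part h ?m < (1 - 1 / 2) * real_part h z + (1 / 2) * real_part h w"
    using sc \<open>z \<noteq> w\<close> zw \<open>T \<subseteq> S\<close> unfolding strictly_convex_on_def
    by (metis half_gt_zero_iff less_numeral_extra(1) field_sum_of_halves less_add_same_cancel1 subsetD)
  moreover have "?g \<bullet> ?m = (?g \<bullet> z + ?g \<bullet> w) / 2"
    by (simp add: inner_add_right)
  ultimately show False by (simp add: bregman_dist_def inner_diff_right)
qed

text \<open>Keeps the midpoint of two optimal points optimal, as the uniqueness argument
  requires.\<close>

lemma convex_optimal_set:
  assumes "convex C" "linear f"
  shows "convex (optimal_set C A b f)"
proof (rule convexI)
  fix y z and u v :: real
  assume *: "y \<in> optimal_set C A b f" "z \<in> optimal_set C A b f" "0 \<le> u" "0 \<le> v" "u + v = 1"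
  let ?p = "u *\<^sub>R y + v *\<^sub>R z"
  have yz: "y \<in> closure C" "z \<in> closure C" "A *v y = b" "A *v z = b"
    "\<And>w. w \<in> closure C \<Longrightarrow> A *v w = b \<Longrightarrow> f y \<le> f w \<and> f z \<le> f w"
    using * by (auto simp: optimal_set_def is_arg_min_linorder)
  have "?p \<in> closure C" using convex_closure[OF assms(1)] yz * by (intro convexD)
  moreover have "A *v ?p = b"
    using yz *(5) by (simp add: matrix_vector_right_distrib matrix_vector_mult_scaleR
        scaleR_left_distrib[symmetric])
  moreover have "f ?p \<le> f w" if "w \<in> closure C" "A *v w = b" for w
  proof -
    have "u * f y + v * f z \<le> f w" using yz(5)[OF that] * by (intro convex_bound_le) auto
    then show ?thesis using assms(2) by (simp add: linear_add linear_cmul)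
  qed
  ultimately show "?p \<in> optimal_set C A b f" by (simp add: optimal_set_def is_arg_min_linorder)
qed

theorem corollary4p1:
  fixes A :: "real ^ 'n ^ 'm" and b :: "real ^ 'm"
    and C \<F> :: "(real ^ 'n) set"
    and h :: "real ^ 'n \<Rightarrow> ereal" and H :: "real ^ 'n \<Rightarrow> real ^ 'n ^ 'n"
    and f :: "real ^ 'n \<Rightarrow> real"
    and x :: "real \<Rightarrow> real ^ 'n" and x0 :: "real ^ 'n"
  defines "H \<equiv> hessian (real_part h)"
    and "\<F> \<equiv> C \<inter> affine_constraint A b"
  assumes "CARD('m) < CARD('n)"
    and "rank A = CARD('m)"
    and "b \<in> range ((*v) A)"
    and "C \<noteq> {}" "open C" "convex C"
    and "\<F> \<noteq> {}"
    and "h \<in> Gamma0"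
    and "legendre_type h" "interior (edom h) = C"
    and "C2_on C (real_part h)" "\<And>y. y \<in> C \<Longrightarrow> sym_pos_def (H y)"
    and "locally_lipschitz_on C H"
    and "bregman_function C h"
    and "linear f"
    and "optimal_set C A b f \<noteq> {}"
    and "x0 \<in> \<F>"
    and "HSD_solution \<F> H A f x0 x"
  shows "\<exists>xs. (\<forall>z. is_arg_min (\<lambda>y. bregman_dist h y x0) (\<lambda>y. y \<in> optimal_set C A b f) z \<longleftrightarrow> z = xs)
            \<and> (x \<longlongrightarrow> xs) at_top"
proof -
  let ?\<phi> = "real_part h" and ?D = "bregman_dist h" and ?S = "optimal_set C A b f"
  have sc: "strictly_convex_on (closure C) ?\<phi>" and dom: "edom h = closure C"
    and cont_h: "continuous_on (closure C) h"
    and level: "\<And>a \<gamma>. a \<in> closure C \<Longrightarrow> bounded {y \<in> C. ?D a y \<le> \<gamma>}"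
    using \<open>bregman_function C h\<close> by (auto simp: bregman_function_def)
  have "\<bar>h y\<bar> \<noteq> \<infinity>" if "y \<in> closure C" for y
    using that dom \<open>h \<in> Gamma0\<close> by (auto simp: edom_def Gamma0_def proper_fun_def)
  \<comment> \<open>Finiteness of \<open>h\<close> on \<open>closure C\<close> transfers continuity
    from \<open>ereal\<close> to the real part.\<close>
  from continuous_on_iff_real[of "closure C" h, OF this]
  have cont_\<phi>: "continuous_on (closure C) ?\<phi>"
    using cont_h unfolding comp_def by blast
  then have cont_D: "continuous_on (closure C) (\<lambda>y. ?D y x0)"
    unfolding bregman_dist_def by (intro continuous_intros)
  have diff: "?\<phi> differentiable (at y)" if "y \<in> C" for y
    using \<open>C2_on C ?\<phi>\<close> that by (auto simp: C2_on_def C1_on_def)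
  \<comment> \<open>The second argument stays in \<open>C\<close>, where the gradient exists; the
    first ranges over the closure because optimal points may lie on the boundary.\<close>
  have nonneg: "?D y z \<ge> 0" if "y \<in> closure C" "z \<in> C" for y z
    using strictly_convex_on_above_tangent[OF sc subsetD[OF closure_subset that(2)] that(1)
        diff[OF that(2)]] by (simp add: bregman_dist_def)
  have x0: "x0 \<in> C" using \<open>x0 \<in> \<F>\<close> by (auto simp: \<F>_def)
  have xF: "x t \<in> C" "A *v x t = b" if "t \<ge> 0" for t
    using \<open>HSD_solution \<F> H A f x0 x\<close> that
    by (auto simp: HSD_solution_def \<F>_def affine_constraint_def)
  have x_cl: "x t \<in> closure C" if "t \<ge> 0" for t using xF(1)[OF that] closure_subset by blast

  have identity: "?D y x0 + t * f y = ?D y (x t) + ?D (x t) x0 + t * f (x t)"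
    if "t \<ge> 0" "A *v y = b" for t y
  proof -
    have "(gradient ?\<phi> (x t) - gradient ?\<phi> x0) \<bullet> (y - x t) = - t * f (y - x t)"
    proof (rule HSD_solution_gradient)
      show "\<F> \<subseteq> C" by (simp add: \<F>_def)
      show "HSD_solution \<F> (hessian ?\<phi>) A f x0 x"
        using \<open>HSD_solution \<F> H A f x0 x\<close> by (simp add: H_def)
      show "sym_pos_def (hessian ?\<phi> y)" if "y \<in> C" for y
        using \<open>\<And>y. y \<in> C \<Longrightarrow> sym_pos_def (H y)\<close> that by (simp add: H_def)
      show "A *v (y - x t) = 0" using that xF by (simp add: matrix_vector_mult_diff_distrib)
    qed fact+
    then show ?thesis
      using bregman_three_points[of h y x0 "x t"] \<open>linear f\<close>
      by (simp add: linear_diff algebra_simps)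
  qed

  have S: "y \<in> closure C" "A *v y = b" "\<And>z. z \<in> closure C \<Longrightarrow> A *v z = b \<Longrightarrow> f y \<le> f z"
    if "y \<in> ?S" for y
    using that by (auto simp: optimal_set_def is_arg_min_linorder)
  have bounds: "?D y (x t) \<le> ?D y x0" "?D (x t) x0 \<le> ?D y x0" "t * (f (x t) - f y) \<le> ?D y x0"
    if "t \<ge> 0" "y \<in> ?S" for t y
  proof -
    have "0 \<le> t * (f (x t) - f y)"
      using S(3)[OF that(2) x_cl xF(2)] that(1) by simp
    moreover have "?D y (x t) \<ge> 0" "?D (x t) x0 \<ge> 0"
      using nonneg S(1)[OF that(2)] xF x_cl x0 that(1) by auto
    ultimately show "?D y (x t) \<le> ?D y x0" "?D (x t) x0 \<le> ?D y x0"
      "t * (f (x t) - f y) \<le> ?D y x0"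
      using identity[OF that(1) S(2)[OF that(2)]] by (simp_all add: algebra_simps)
  qed

  obtain a where a: "a \<in> ?S" using \<open>?S \<noteq> {}\<close> by blast
  \<comment> \<open>The trajectory stays in a single sublevel set of \<open>?D a\<close>, bounded by
    the Bregman property.\<close>
  have bdd: "bounded (x ` {0..})"
    by (rule bounded_subset[OF level[OF S(1)[OF a], of "?D a x0"]]) (use bounds(1) xF a in auto)
  let ?min = "is_arg_min (\<lambda>y. ?D y x0) (\<lambda>y. y \<in> ?S)"
  have cluster: "?min z"
    if s: "filterlim s at_top sequentially" and lim: "(\<lambda>n. x (s n)) \<longlonglongrightarrow> z" for s :: "nat \<Rightarrow> real" and z
  proof -
    \<comment> \<open>Early terms of \<open>s\<close> may be negative, where nothing is known about
      \<open>x\<close>, and the estimate for \<open>f\<close> divides by \<open>s n\<close>.\<close>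
    have s_pos: "\<forall>\<^sub>F n in sequentially. s n > 0"
      using s by (rule eventually_compose_filterlim[OF eventually_gt_at_top])
    have z: "z \<in> closure C"
      by (rule Lim_in_closed_set[OF closed_closure _ _ lim])
         (use s_pos in \<open>auto elim!: eventually_mono intro: x_cl\<close>)
    have "(\<lambda>n. A *v x (s n)) \<longlonglongrightarrow> A *v z"
      by (rule bounded_linear.tendsto[OF matrix_vector_mul_bounded_linear lim])
    moreover have "\<forall>\<^sub>F n in sequentially. A *v x (s n) = b"
      using s_pos by eventually_elim (simp add: xF)
    ultimately have Az: "A *v z = b"
      by (rule LIMSEQ_unique[OF _ tendsto_eventually])
    have "f z \<le> f a"
    proof (rule tendsto_le[OF trivial_limit_sequentially])
      show "(\<lambda>n. f (x (s n))) \<longlonglongrightarrow> f z"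
        by (rule bounded_linear.tendsto[OF _ lim])
           (use \<open>linear f\<close> in \<open>simp add: linear_conv_bounded_linear\<close>)
      \<comment> \<open>Dividing the third bound by time shows that the optimality gap is at most
        this quotient.\<close>
      have "(\<lambda>n. ?D a x0 / s n) \<longlonglongrightarrow> 0"
        using tendsto_const s by (rule tendsto_divide_0[OF _ filterlim_at_top_imp_at_infinity])
      from tendsto_add[OF tendsto_const this]
      show "(\<lambda>n. f a + ?D a x0 / s n) \<longlonglongrightarrow> f a" by simp
      show "\<forall>\<^sub>F n in sequentially. f (x (s n)) \<le> f a + ?D a x0 / s n"
        using s_pos
      proof eventually_elim
        case (elim n)
        with bounds(3)[OF less_imp_le[OF elim] a] show ?case by (simp add: field_simps)
      qed
    qed
    then have zS: "z \<in> ?S"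
      using S(3)[OF a] z Az by (force simp: optimal_set_def is_arg_min_linorder)
    \<comment> \<open>The second bound holds for every optimal \<open>y\<close>, and it survives the
      limit because \<open>?D _ x0\<close> is continuous up to the boundary.\<close>
    have "?D z x0 \<le> ?D y x0" if "y \<in> ?S" for y
    proof (rule tendsto_upperbound[OF _ _ trivial_limit_sequentially])
      show "(\<lambda>n. ?D (x (s n)) x0) \<longlonglongrightarrow> ?D z x0"
        by (rule continuous_on_tendsto_compose[OF cont_D lim z])
           (use s_pos in \<open>auto elim!: eventually_mono intro: x_cl\<close>)
      show "\<forall>\<^sub>F n in sequentially. ?D (x (s n)) x0 \<le> ?D y x0"
        using s_pos by eventually_elim (use bounds(2) that in simp)
    qed
    then show ?thesis using zS by (simp add: is_arg_min_linorder)
  qed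
  have uniq: "z = w" if "?min z" "?min w" for z w
    using sc _ _ that
    by (rule unique_arg_min_bregman_dist)
       (use S(1) convex_optimal_set[OF \<open>convex C\<close> \<open>linear f\<close>] in auto)

  \<comment> \<open>Existence of a minimizer comes from the flow itself, as a cluster point along
    integer times.\<close>
  have "bounded (range (\<lambda>n. x (real n)))"
    by (rule bounded_subset[OF bdd]) auto
  then obtain xs r where r: "strict_mono (r :: nat \<Rightarrow> nat)" "((\<lambda>n. x (real n)) \<circ> r) \<longlonglongrightarrow> xs"
    using bounded_imp_convergent_subsequence by blast
  have xs: "?min xs"
    using filterlim_compose[OF filterlim_real_sequentially filterlim_subseq[OF r(1)]] r(2)
    by (intro cluster[of "\<lambda>n. real (r n)"]) (simp_all add: comp_def)
  have "(x \<longlongrightarrow> xs) at_top"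
    by (rule tendsto_of_unique_cluster_point[OF bdd]) (rule uniq[OF cluster xs])
  with xs uniq show ?thesis by blast
qed

end
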